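(* Consider problem (P) and its dual (D) given in the context. Assume that the KKT solution set $\mathcal{T}_l^{-1}(0)$ is non-empty. Suppose that the following local growth conditions hold: (i) for any $w\in\mathrm{dom}(h)$ there exist $\kappa_1>0$ and a neighborhood $\mathcal{W}\subseteq\mathbb{W}$ of $w$ such that $h(w')\ge h(w)+\langle\nabla h(w),w'-w\rangle+\kappa_1\|w'-w\|^2$ for all $w'\in\mathcal{W}$; (ii) for any $(x,v)\in\mathrm{gph}(\partial p)$ there exist $\kappa_2>0$ and a neighborhood $\mathcal{U}\subseteq\mathbb{X}$ of $x$ such that $p(x')\ge p(x)+\langle v,x'-x\rangle+\kappa_2\,\mathrm{dist}^2(x',(\partial p)^{-1}(v))$ for all $x'\in\mathcal{U}$. Suppose moreover that there exists an optimal solution $(\bar y,\bar w,\bar s)\in\mathcal{T}_\psi^{-1}(0)$ of (D) such that the collection of three sets $\{\overline{\mathcal{V}},\mathcal{G}_1(\bar y),\mathcal{G}_2(\bar y)\}$ is boundedly linearly regular. Then the second order growth condition holds at any $\bar x\in\mathcal{T}_\phi^{-1}(0)$ with respect to the optimal solution set $\mathcal{T}_\phi^{-1}(0)$ of (P); that is, for every $\bar x\in\mathcal{T}_\phi^{-1}(0)$ there exist $\kappa>0$ and a neighborhood $\mathcal{U}$ of $\bar x$ such that $$\theta(x)\ge\theta(\bar x)+\kappa\,\mathrm{dist}^2(x,\mathcal{T}_\phi^{-1}(0))\quad\text{for all }x\in\mathcal{U}\cap\{x\in\mathbb{X}: b-\mathcal{A}x\in\mathcal{Q}^\circ\}.$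$
   Context: $\mathbb{X},\mathbb{Y},\mathbb{W}$ are finite dimensional real Euclidean spaces; $\mathcal{F}:\mathbb{X}\to\mathbb{W}$, $\mathcal{A}:\mathbb{X}\to\mathbb{Y}$ are linear with adjoints $\mathcal{F}^*,\mathcal{A}^*$; $\mathcal{Q}\subseteq\mathbb{Y}$ is a convex polyhedral cone with polar $\mathcal{Q}^\circ$ and normal cone $\mathcal{N}_{\mathcal{Q}}(\cdot)$; $c\in\mathbb{X}$, $b\in\mathbb{Y}$; $p:\mathbb{X}\to(-\infty,+\infty]$ is closed proper convex; $h:\mathbb{W}\to(-\infty,+\infty]$ is continuously differentiable on $\mathrm{dom}(h)$, which is a non-empty open convex set, and strictly convex on any convex subset of $\mathrm{dom}(h)$. $h^*,p^*$ are conjugates. (P): $\min\{\theta(x):=h(\mathcal{F}x)+\langle c,x\rangle+p(x)\ :\ b-\mathcal{A}x\in\mathcal{Q}^\circ\}$. (D): $\min\{\delta_{\mathcal{Q}}(y)-\langle b,y\rangle+h^*(-w)+p^*(-s)\ :\ \mathcal{A}^*y+\mathcal{F}^*w+s=c\}$, where $\delta_{\mathcal{Q}}$ is the indicator function. $\mathcal{T}_\phi^{-1}(0)$ denotes the optimal solution set of (P), $\mathcal{T}_\psi^{-1}(0)$ that of (D), and $\mathcal{T}_l^{-1}(0)$ the set of KKT points $(y,w,s,x)\in\mathbb{Y}\times\mathbb{W}\times\mathbb{X}\times\mathbb{X}$, i.e. solutions of $0\in-b+\mathcal{A}x+\mathcal{N}_{\mathcal{Q}}(y)$, $0\in\mathcal{F}x-\partial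 h^*(-w)$, $0\in x-\partial p^*(-s)$, $0=c-(\mathcal{A}^*y+\mathcal{F}^*w+s)$. The value $\mathcal{F}x$ is the same for all $x\in\mathcal{T}_\phi^{-1}(0)$; set $\bar\zeta:=\mathcal{F}x$ for any $x\in\mathcal{T}_\phi^{-1}(0)$, $\bar\eta:=\mathcal{F}^*\nabla h(\bar\zeta)+c$, $\overline{\mathcal{V}}:=\{x\in\mathbb{X}:\mathcal{F}x=\bar\zeta\}$, $\mathcal{G}_1(y):=(\partial p)^{-1}(\mathcal{A}^*y-\bar\eta)$, $\mathcal{G}_2(y):=\{x:0\in\mathcal{A}x-b+\mathcal{N}_{\mathcal{Q}}(y)\}$. Closed convex sets $D_1,\dots,D_m\subseteq\mathbb{X}$ with non-empty intersection $D$ are boundedly linearly regular if for every bounded set $\mathbb{B}\subseteq\mathbb{X}$ there is $\kappa>0$ with $\mathrm{dist}(x,D)\le\kappa\max\{\mathrm{dist}(x,D_1),\dots,\mathrm{dist}(x,D_m)\}$ for all $x\in\mathbb{B}$. *)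

theory Defs
  imports "HOL-Analysis.Analysis"
begin

text \<open>
  Functions into \<open>(-\<infinity>, +\<infinity>]\<close> are functions into \<^typ>\<open>ereal\<close> that never take the value
  \<open>-\<infinity>\<close>. Under this restriction none of the sums below is of the form \<open>\<infinity> + (-\<infinity>)\<close>.
\<close>

definition edom :: "('a \<Rightarrow> ereal) \<Rightarrow> 'a set" where
  "edom f = {x. f x < \<infinity>}"

definition proper :: "('a \<Rightarrow> ereal) \<Rightarrow> bool" where
  "proper f \<longleftrightarrow> (\<forall>x. f x \<noteq> -\<infinity>) \<and> edom f \<noteq> {}"

definition epi :: "('a \<Rightarrow> ereal) \<Rightarrow> ('a \<times> real) set" where
  "epi f = {(x, r). f x \<le> ereal r}"

definition closed_proper_convex :: "('a::euclidean_space \<Rightarrow> ereal) \<Rightarrow> bool" where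
  "closed_proper_convex f \<longleftrightarrow> proper f \<and> convex (epi f) \<and> closed (epi f)"

definition strictly_convex_on :: "'a::real_vector set \<Rightarrow> ('a \<Rightarrow> ereal) \<Rightarrow> bool" where
  "strictly_convex_on C f \<longleftrightarrow>
     (\<forall>x\<in>C. \<forall>y\<in>C. \<forall>t. x \<noteq> y \<longrightarrow> 0 < t \<longrightarrow> t < 1 \<longrightarrow>
        f ((1 - t) *\<^sub>R x + t *\<^sub>R y) < ereal (1 - t) * f x + ereal t * f y)"

text \<open>
  The gradient of the real-valued function that \<open>f\<close> induces near a point in the interior
  of its domain; \<^const>\<open>real_of_ereal\<close> is only relevant at finite values there.
\<close>

definition grad :: "('a::euclidean_space \<Rightarrow> ereal) \<Rightarrow> 'a \<Rightarrow> 'a" where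
  "grad f x = (THE D. GDERIV (\<lambda>z. real_of_ereal (f z)) x :> D)"

definition continuously_differentiable_on ::
    "'a::euclidean_space set \<Rightarrow> ('a \<Rightarrow> ereal) \<Rightarrow> bool" where
  "continuously_differentiable_on S f \<longleftrightarrow>
     (\<lambda>z. real_of_ereal (f z)) differentiable_on S \<and> continuous_on S (grad f)"

definition conjugate :: "('a::euclidean_space \<Rightarrow> ereal) \<Rightarrow> 'a \<Rightarrow> ereal" where
  "conjugate f v = (SUP x. ereal (inner v x) - f x)"

text \<open>For proper \<open>f\<close> the subdifferential is empty outside the domain of \<open>f\<close>.\<close>

definition subdiff :: "('a::euclidean_space \<Rightarrow> ereal) \<Rightarrow> 'a \<Rightarrow> 'a set" where
  "subdiff f x = {v. \<forall>z. f z \<ge> f x + ereal (inner v (z - x))}"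

definition subdiff_inv :: "('a::euclidean_space \<Rightarrow> ereal) \<Rightarrow> 'a \<Rightarrow> 'a set" where
  "subdiff_inv f v = {x. v \<in> subdiff f x}"

definition indicat :: "'a set \<Rightarrow> 'a \<Rightarrow> ereal" where
  "indicat S y = (if y \<in> S then 0 else \<infinity>)"

definition polar_cone :: "'a::euclidean_space set \<Rightarrow> 'a set" where
  "polar_cone K = {v. \<forall>y\<in>K. inner v y \<le> 0}"

definition normal_cone :: "'a::euclidean_space set \<Rightarrow> 'a \<Rightarrow> 'a set" where
  "normal_cone K y = (if y \<in> K then {v. \<forall>z\<in>K. inner v (z - y) \<le> 0} else {})"

definition boundedly_linearly_regular :: "'a::euclidean_space set set \<Rightarrow> bool" where
  "boundedly_linearly_regular \<D> \<longleftrightarrow>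
     finite \<D> \<and> \<D> \<noteq> {} \<and> (\<forall>D\<in>\<D>. closed D \<and> convex D) \<and> \<Inter>\<D> \<noteq> {} \<and>
     (\<forall>B. bounded B \<longrightarrow>
        (\<exists>\<kappa>>0. \<forall>x\<in>B. infdist x (\<Inter>\<D>) \<le> \<kappa> * Max ((\<lambda>D. infdist x D) ` \<D>)))"

text \<open>A point at which the objective is infinite is not an optimal solution.\<close>

definition minimizers :: "('a \<Rightarrow> ereal) \<Rightarrow> 'a set \<Rightarrow> 'a set" where
  "minimizers f S = {x \<in> S. \<bar>f x\<bar> \<noteq> \<infinity> \<and> (\<forall>x'\<in>S. f x \<le> f x')}"

definition primal_obj ::
    "('x::euclidean_space \<Rightarrow> 'w::euclidean_space) \<Rightarrow> 'x \<Rightarrow> ('w \<Rightarrow> ereal) \<Rightarrow> ('x \<Rightarrow> ereal) \<Rightarrow>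
     'x \<Rightarrow> ereal" where
  "primal_obj F c h p x = h (F x) + ereal (inner c x) + p x"

definition primal_feasible ::
    "('x::euclidean_space \<Rightarrow> 'y::euclidean_space) \<Rightarrow> 'y set \<Rightarrow> 'y \<Rightarrow> 'x set" where
  "primal_feasible A Q b = {x. b - A x \<in> polar_cone Q}"

definition primal_solutions ::
    "('x::euclidean_space \<Rightarrow> 'w::euclidean_space) \<Rightarrow> ('x \<Rightarrow> 'y::euclidean_space) \<Rightarrow>
     'y set \<Rightarrow> 'y \<Rightarrow> 'x \<Rightarrow> ('w \<Rightarrow> ereal) \<Rightarrow> ('x \<Rightarrow> ereal) \<Rightarrow> 'x set" where
  "primal_solutions F A Q b c h p =
     minimizers (primal_obj F c h p) (primal_feasible A Q b)"

definition dual_obj ::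
    "'y::euclidean_space set \<Rightarrow> 'y \<Rightarrow> ('w::euclidean_space \<Rightarrow> ereal) \<Rightarrow>
     ('x::euclidean_space \<Rightarrow> ereal) \<Rightarrow> 'y \<times> 'w \<times> 'x \<Rightarrow> ereal" where
  "dual_obj Q b h p =
     (\<lambda>(y, w, s). indicat Q y - ereal (inner b y) + conjugate h (- w) + conjugate p (- s))"

definition dual_feasible ::
    "('x::euclidean_space \<Rightarrow> 'w::euclidean_space) \<Rightarrow> ('x \<Rightarrow> 'y::euclidean_space) \<Rightarrow>
     'x \<Rightarrow> ('y \<times> 'w \<times> 'x) set" where
  "dual_feasible F A c = {(y, w, s). adjoint A y + adjoint F w + s = c}"

definition dual_solutions ::
    "('x::euclidean_space \<Rightarrow> 'w::euclidean_space) \<Rightarrow> ('x \<Rightarrow> 'y::euclidean_space) \<Rightarrow>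
     'y set \<Rightarrow> 'y \<Rightarrow> 'x \<Rightarrow> ('w \<Rightarrow> ereal) \<Rightarrow> ('x \<Rightarrow> ereal) \<Rightarrow> ('y \<times> 'w \<times> 'x) set" where
  "dual_solutions F A Q b c h p = minimizers (dual_obj Q b h p) (dual_feasible F A c)"

definition kkt_points ::
    "('x::euclidean_space \<Rightarrow> 'w::euclidean_space) \<Rightarrow> ('x \<Rightarrow> 'y::euclidean_space) \<Rightarrow>
     'y set \<Rightarrow> 'y \<Rightarrow> 'x \<Rightarrow> ('w \<Rightarrow> ereal) \<Rightarrow> ('x \<Rightarrow> ereal) \<Rightarrow>
     ('y \<times> 'w \<times> 'x \<times> 'x) set" where
  "kkt_points F A Q b c h p = {(y, w, s, x).
     0 \<in> (\<lambda>u. - b + A x + u) ` normal_cone Q y \<and>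
     0 \<in> (\<lambda>u. F x - u) ` subdiff (conjugate h) (- w) \<and>
     0 \<in> (\<lambda>u. x - u) ` subdiff (conjugate p) (- s) \<and>
     0 = c - (adjoint A y + adjoint F w + s)}"

text \<open>
  The common value of \<open>F\<close> on the primal solution set; it does not depend on the chosen
  solution, see \<open>primal_solutions_same_image\<close> below.
\<close>

definition zeta_bar ::
    "('x::euclidean_space \<Rightarrow> 'w::euclidean_space) \<Rightarrow> ('x \<Rightarrow> 'y::euclidean_space) \<Rightarrow>
     'y set \<Rightarrow> 'y \<Rightarrow> 'x \<Rightarrow> ('w \<Rightarrow> ereal) \<Rightarrow> ('x \<Rightarrow> ereal) \<Rightarrow> 'w" where
  "zeta_bar F A Q b c h p = F (SOME x. x \<in> primal_solutions F A Q b c h p)"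

definition eta_bar ::
    "('x::euclidean_space \<Rightarrow> 'w::euclidean_space) \<Rightarrow> ('x \<Rightarrow> 'y::euclidean_space) \<Rightarrow>
     'y set \<Rightarrow> 'y \<Rightarrow> 'x \<Rightarrow> ('w \<Rightarrow> ereal) \<Rightarrow> ('x \<Rightarrow> ereal) \<Rightarrow> 'x" where
  "eta_bar F A Q b c h p = adjoint F (grad h (zeta_bar F A Q b c h p)) + c"

definition V_bar ::
    "('x::euclidean_space \<Rightarrow> 'w::euclidean_space) \<Rightarrow> ('x \<Rightarrow> 'y::euclidean_space) \<Rightarrow>
     'y set \<Rightarrow> 'y \<Rightarrow> 'x \<Rightarrow> ('w \<Rightarrow> ereal) \<Rightarrow> ('x \<Rightarrow> ereal) \<Rightarrow> 'x set" where
  "V_bar F A Q b c h p = {x. F x = zeta_bar F A Q b c h p}"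

definition G1 ::
    "('x::euclidean_space \<Rightarrow> 'w::euclidean_space) \<Rightarrow> ('x \<Rightarrow> 'y::euclidean_space) \<Rightarrow>
     'y set \<Rightarrow> 'y \<Rightarrow> 'x \<Rightarrow> ('w \<Rightarrow> ereal) \<Rightarrow> ('x \<Rightarrow> ereal) \<Rightarrow> 'y \<Rightarrow> 'x set" where
  "G1 F A Q b c h p y = subdiff_inv p (adjoint A y - eta_bar F A Q b c h p)"

definition G2 ::
    "('x::euclidean_space \<Rightarrow> 'y::euclidean_space) \<Rightarrow> 'y set \<Rightarrow> 'y \<Rightarrow> 'y \<Rightarrow> 'x set" where
  "G2 A Q b y = {x. 0 \<in> (\<lambda>u. A x - b + u) ` normal_cone Q y}"

lemma primal_solutions_same_image:
  fixes F :: "'x::euclidean_space \<Rightarrow> 'w::euclidean_space"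
    and A :: "'x \<Rightarrow> 'y::euclidean_space"
  assumes lin: "linear F" "linear A"
    and p: "closed_proper_convex p"
    and h: "\<forall>w. h w \<noteq> -\<infinity>" "convex (edom h)"
      "\<forall>C. convex C \<and> C \<subseteq> edom h \<longrightarrow> strictly_convex_on C h"
    and x1: "x1 \<in> primal_solutions F A Q b c h p"
    and x2: "x2 \<in> primal_solutions F A Q b c h p"
  shows "F x1 = F x2"
proof (rule ccontr)
  assume ne: "F x1 \<noteq> F x2"
  let ?th = "primal_obj F c h p"
  define m where "m = (1 - 1/2) *\<^sub>R x1 + (1/2) *\<^sub>R x2"
  have pn: "p x \<noteq> -\<infinity>" for x using p by (auto simp: closed_proper_convex_def proper_def)
  have fin1: "\<bar>?th x1\<bar> \<noteq> \<infinity>" "\<bar>?th x2\<bar> \<noteq> \<infinity>"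
    and opt: "?th x1 \<le> ?th x" "?th x2 \<le> ?th x" if "x \<in> primal_feasible A Q b" for x
    using x1 x2 that by (auto simp: primal_solutions_def minimizers_def)
  have feas: "x1 \<in> primal_feasible A Q b" "x2 \<in> primal_feasible A Q b"
    using x1 x2 by (auto simp: primal_solutions_def minimizers_def)
  have Am: "A m = (1/2) *\<^sub>R A x1 + (1/2) *\<^sub>R A x2"
    by (simp add: m_def linear_add[OF lin(2)] linear_cmul[OF lin(2)])
  have mfeas: "m \<in> primal_feasible A Q b"
    using feas by (fastforce simp: primal_feasible_def polar_cone_def Am inner_simps)
  have hf: "\<bar>h (F x)\<bar> \<noteq> \<infinity>" "\<bar>p x\<bar> \<noteq> \<infinity>" if "\<bar>?th x\<bar> \<noteq> \<infinity>" for x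
    using that h(1) pn[of x]
    by (cases "h (F x)"; cases "p x"; force simp: primal_obj_def)+
  obtain h1 h2 p1 p2 where r: "h (F x1) = ereal h1" "h (F x2) = ereal h2"
      "p x1 = ereal p1" "p x2 = ereal p2"
    using hf fin1[OF feas(1)] by (metis ereal_real)
  have "strictly_convex_on (edom h) h" using h by blast
  then have hm: "h ((1 - 1/2) *\<^sub>R F x1 + (1/2) *\<^sub>R F x2)
      < ereal (1 - 1/2) * h (F x1) + ereal (1/2) * h (F x2)"
    using ne r unfolding strictly_convex_on_def
    by (elim ballE[where x = "F x1"] ballE[where x = "F x2"] allE[where x = "1/2"])
      (simp_all add: edom_def)
  have Fm: "F m = (1 - 1/2) *\<^sub>R F x1 + (1/2) *\<^sub>R F x2"
    by (simp add: m_def linear_add[OF lin(1)] linear_cmul[OF lin(1)])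
  have hm': "h (F m) < ereal (h1/2 + h2/2)" using hm r by (simp add: Fm)
  have "(1 - 1/2) *\<^sub>R (x1, p1) + (1/2::real) *\<^sub>R (x2, p2) \<in> epi p"
    by (rule convexD_alt) (use p r in \<open>auto simp: epi_def closed_proper_convex_def\<close>)
  then have pm: "p m \<le> ereal (p1/2 + p2/2)" by (simp add: epi_def m_def)
  have cm: "inner c m = inner c x1 / 2 + inner c x2 / 2" by (simp add: m_def inner_simps)
  obtain hr pr where r': "h (F m) = ereal hr" "p m = ereal pr"
    using hm' pm h(1) pn[of m] by (cases "h (F m)"; cases "p m") auto
  have "h1 + inner c x1 + p1 \<le> hr + inner c m + pr" "h2 + inner c x2 + p2 \<le> hr + inner c m + pr"
    using opt[OF mfeas] r r' by (auto simp: primal_obj_def)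
  moreover have "hr < h1/2 + h2/2" "pr \<le> p1/2 + p2/2" using hm' pm r' by auto
  ultimately show False using cm by argo
qed

end

theory Submission
  imports Defs
begin

text \<open>
  A point of the non-empty intersection of \<^term>\<open>V_bar F A Q b c h p\<close>,
  \<^term>\<open>G1 F A Q b c h p y\<close> and \<^term>\<open>G2 A Q b y\<close> is a primal solution: the linear lower
  bound on \<^term>\<open>p\<close> given by the multiplier compares it with a known solution, the two having the
  same image under \<^term>\<open>F\<close>. Conversely this comparison is tight, so every primal solution lies
  in the intersection. No duality theory is needed.

  Adding the growth conditions of \<^term>\<open>h\<close> and \<^term>\<open>p\<close> bounds the increase of the objective
  near a solution from below by the squared residual of \<^term>\<open>V_bar F A Q b c h p\<close>, the squared
  distance to \<^term>\<open>G1 F A Q b c h p y\<close> and the complementarity gap \<open>A x \<bullet> y - b \<bullet> y\<close>. By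
  polyhedrality of \<^term>\<open>Q\<close> the gap dominates, near the solution, the distance to
  \<^term>\<open>G2 A Q b y\<close>, and bounded linear regularity combines the three distances.
\<close>

section \<open>Error bounds for faces of polytopes and fibres of linear maps\<close>

text \<open>Moving the weight of the generators off the minimal face to \<open>z\<close> displaces
  \<open>x\<close> by at most the weighted sum of their distances to \<open>z\<close>. As there are
  finitely many, each such distance is at most a common multiple of the gap.\<close>

lemma polytope_face_error_bound:
  fixes d :: "'a::euclidean_space"
  assumes P: "polytope P" and z: "z \<in> P" and min: "\<And>x. x \<in> P \<Longrightarrow> inner d z \<le> inner d x"
  shows "\<exists>C>0. \<forall>x\<in>P. infdist x {u\<in>P. inner d u = inner d z} \<le> C * (inner d x - inner d z)"
proof -
  obtain S where S: "finite S" "P = convex hull S"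
    using P by (auto simp: polytope_def)
  have conv: "convex P" by (simp add: S)
  have SP: "v \<in> P" if "v \<in> S" for v
    using that S hull_inc by fastforce
  define gap where "gap v = inner d v - inner d z" for v
  have gap0: "0 \<le> gap v" if "v \<in> P" for v
    using min[OF that] by (simp add: gap_def)
  \<comment> \<open>Generators with gap 0 contribute 0, the value of division by zero. The leading 1
    keeps \<open>C\<close> positive even if the sum vanishes.\<close>
  define C where "C = 1 + (\<Sum>v\<in>S. norm (v - z) / gap v)"
  have Cpos: "C > 0"
    unfolding C_def using gap0 SP by (intro add_pos_nonneg sum_nonneg) auto
  have bad: "norm (v - z) \<le> C * gap v" if v: "v \<in> S" "gap v \<noteq> 0" for v
  proof -
    have "norm (v - z) / gap v \<le> (\<Sum>v\<in>S. norm (v - z) / gap v)"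
      by (rule member_le_sum) (use v S gap0 SP in auto)
    then have "norm (v - z) / gap v \<le> C" by (simp add: C_def)
    then show ?thesis
      using v gap0[OF SP[OF v(1)]] by (simp add: divide_simps split: if_splits)
  qed
  have "infdist x {u\<in>P. inner d u = inner d z} \<le> C * gap x" if x: "x \<in> P" for x
  proof -
    obtain u where u: "\<And>v. v \<in> S \<Longrightarrow> 0 \<le> u v" "sum u S = 1" "(\<Sum>v\<in>S. u v *\<^sub>R v) = x"
      using x unfolding S(2) convex_hull_finite[OF S(1)] by auto
    \<comment> \<open>Move the weight of the vertices off the face to \<open>z\<close>.\<close>
    define g where "g v = (if gap v = 0 then v else z)" for v
    define x' where "x' = (\<Sum>v\<in>S. u v *\<^sub>R g v)"
    \<comment> \<open>\<open>gap\<close> is affine and the weights sum to 1. It is applied both to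
      the shifted point and to \<open>x\<close> itself.\<close>
    have gap_sum: "(\<Sum>v\<in>S. u v * gap (k v)) = gap (\<Sum>v\<in>S. u v *\<^sub>R k v)" for k
      using u(2) by (simp add: gap_def right_diff_distrib sum_subtractf inner_sum_right
          flip: sum_distrib_right)
    have "x' \<in> P"
      unfolding x'_def by (rule convex_sum[OF S(1) conv u(2)]) (use u SP z in \<open>auto simp: g_def\<close>)
    moreover have "gap x' = 0"
      unfolding x'_def gap_sum[symmetric] by (rule sum.neutral) (auto simp: g_def gap_def)
    ultimately have "infdist x {u\<in>P. inner d u = inner d z} \<le> dist x x'"
      by (intro infdist_le) (auto simp: gap_def)
    also have "dist x x' = norm (\<Sum>v\<in>S. u v *\<^sub>R (v - g v))"
      by (simp add: dist_norm x'_def scaleR_diff_right sum_subtractf u(3))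
    also have "\<dots> \<le> (\<Sum>v\<in>S. C * (u v * gap v))"
    proof (rule sum_norm_le)
      fix v assume v: "v \<in> S"
      show "norm (u v *\<^sub>R (v - g v)) \<le> C * (u v * gap v)"
        using mult_left_mono[OF bad u(1), OF v _ v] u(1)[OF v]
        by (auto simp: g_def mult.left_commute)
    qed
    also have "\<dots> = C * gap x"
      using gap_sum[of "\<lambda>v. v"] u(3) by (simp flip: sum_distrib_left)
    finally show ?thesis .
  qed
  then show ?thesis using Cpos by (auto simp: gap_def)
qed

text \<open>A linear right inverse of \<open>F\<close> on its range corrects the residual; its
  operator bound is the constant.\<close>

lemma linear_fibre_error_bound:
  fixes F :: "'a::euclidean_space \<Rightarrow> 'b::euclidean_space"
  assumes F: "linear F"
  shows "\<exists>C>0. \<forall>x. infdist x {u. F u = F z} \<le> C * norm (F x - F z)"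
proof -
  obtain g where g: "linear g" "\<And>v. F (g (F v)) = F v"
    using linear_exists_right_inverse_on[OF F subspace_UNIV] by auto
  obtain C where C: "C > 0" "\<And>w. norm (g w) \<le> C * norm w"
    using linear_bounded_pos[OF g(1)] by auto
  have "infdist x {u. F u = F z} \<le> C * norm (F x - F z)" for x
  proof -
    have "x - g (F x - F z) \<in> {u. F u = F z}"
      using g(2)[of "x - z"] by (simp add: linear_diff[OF F])
    then have "infdist x {u. F u = F z} \<le> dist x (x - g (F x - F z))"
      by (rule infdist_le)
    also have "\<dots> \<le> C * norm (F x - F z)"
      using C(2) by (simp add: dist_norm)
    finally show ?thesis .
  qed
  then show ?thesis using C(1) by blast
qed

section \<open>Polyhedral cones, feasibility and complementarity\<close>

text \<open>Cutting \<open>Q\<close> with a box around 0 gives a polytope, and every point of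
  \<open>Q\<close> scales into it. The finitely many points spanning this polytope therefore
  generate the cone and determine its polar.\<close>

lemma polyhedral_cone_polar_finite:
  fixes Q :: "'a::euclidean_space set"
  assumes Q: "polyhedron Q" "convex_cone Q"
  shows "\<exists>S. finite S \<and> polar_cone Q = {v. \<forall>s\<in>S. inner v s \<le> 0}"
proof -
  define B :: "'a set" where "B = cbox (- One) One"
  have "polytope (Q \<inter> B)"
    using Q(1) by (simp add: B_def polyhedron_Int_polytope polytope_interval)
  then obtain S where S: "finite S" "Q \<inter> B = convex hull S"
    by (auto simp: polytope_def)
  have SQ: "S \<subseteq> Q" using hull_subset[of S convex] by (simp flip: S(2))
  have "v \<in> polar_cone Q" if v: "\<forall>s\<in>S. inner v s \<le> 0" for v
    unfolding polar_cone_def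
  proof safe
    fix y assume y: "y \<in> Q"
    \<comment> \<open>This factor brings the norm, hence every coordinate, to at most 1; adding 1
      covers \<open>y = 0\<close>.\<close>
    define t where "t = 1 / (1 + norm y)"
    have t: "t > 0" by (simp add: t_def add_pos_nonneg)
    have "t *\<^sub>R y \<in> Q" using Q(2) y t by (simp add: convex_cone_iff)
    moreover have "t *\<^sub>R y \<in> B"
    proof -
      have "norm (t *\<^sub>R y) \<le> 1" by (simp add: t_def divide_simps add_pos_nonneg not_less)
      then have "\<bar>inner (t *\<^sub>R y) i\<bar> \<le> 1" if "i \<in> Basis" for i
        using Basis_le_norm[OF that] order_trans by blast
      then show ?thesis
        unfolding B_def mem_box by (simp del: inner_scaleR_left) (metis abs_le_D1 abs_le_D2 minus_le_iff)
    qed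
    ultimately have "t *\<^sub>R y \<in> convex hull S" using S(2) by blast
    moreover have "convex hull S \<subseteq> {y. inner v y \<le> 0}"
      by (rule hull_minimal) (use v convex_halfspace_le in auto)
    ultimately show "inner v y \<le> 0" using t by (auto simp: mult_le_0_iff)
  qed
  then have "polar_cone Q = {v. \<forall>s\<in>S. inner v s \<le> 0}"
    using SQ by (auto simp: polar_cone_def)
  then show ?thesis using S(1) by blast
qed

lemma polyhedron_primal_feasible:
  fixes A :: "'x::euclidean_space \<Rightarrow> 'y::euclidean_space"
  assumes A: "linear A" and Q: "polyhedron Q" "convex_cone Q"
  shows "polyhedron (primal_feasible A Q b)"
proof -
  obtain S where S: "finite S" "polar_cone Q = {v. \<forall>s\<in>S. inner v s \<le> 0}"
    using polyhedral_cone_polar_finite[OF Q] by blast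
  have "primal_feasible A Q b = (\<Inter>s\<in>S. {x. inner (adjoint A s) x \<ge> inner b s})"
    by (auto simp: primal_feasible_def S(2) inner_diff_left adjoint_works[OF A]
        inner_commute[of "adjoint A _"])
  then show ?thesis
    using S(1) by (auto intro!: polyhedron_Inter simp: polyhedron_halfspace_ge)
qed

text \<open>Testing a normal vector against the points 0 and \<open>2 *\<^sub>R y\<close> of the
  cone forces \<open>inner v y = 0\<close>.\<close>

lemma normal_cone_convex_cone:
  fixes Q :: "'a::euclidean_space set"
  assumes Q: "convex_cone Q"
  shows "v \<in> normal_cone Q y \<longleftrightarrow> y \<in> Q \<and> v \<in> polar_cone Q \<and> inner v y = 0"
proof (cases "y \<in> Q")
  case True
  have "inner v y = 0 \<and> v \<in> polar_cone Q" if n: "\<forall>z\<in>Q. inner v (z - y) \<le> 0"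
  proof -
    have "0 \<in> Q" "2 *\<^sub>R y \<in> Q"
      using Q True unfolding convex_cone_iff by (blast, force)
    with n have "inner v (0 - y) \<le> 0" "inner v (2 *\<^sub>R y - y) \<le> 0" by blast+
    then have 0: "inner v y = 0" by (simp add: inner_diff_right)
    with n show ?thesis by (simp add: polar_cone_def inner_diff_right)
  qed
  then show ?thesis
    using True by (auto simp: normal_cone_def polar_cone_def inner_diff_right)
qed (simp add: normal_cone_def)

text \<open>This presents \<open>G2\<close> as the face of the feasible polyhedron with zero
  complementarity gap, a form suited to the error bound for faces.\<close>

lemma G2_eq:
  assumes "convex_cone Q" "y \<in> Q"
  shows "G2 A Q b y = {x \<in> primal_feasible A Q b. inner (A x) y = inner b y}"
proof -
  have "x \<in> G2 A Q b y \<longleftrightarrow> b - A x \<in> normal_cone Q y" for x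
    by (auto simp: G2_def image_iff algebra_simps intro: bexI[of _ "b - A x"])
  moreover have "inner (b - A x) y = 0 \<longleftrightarrow> inner (A x) y = inner b y" for x
    unfolding inner_diff_left by linarith
  ultimately show ?thesis
    using assms(2) unfolding normal_cone_convex_cone[OF assms(1)] primal_feasible_def by blast
qed

section \<open>Primal solutions and the multiplier\<close>

lemma primal_solutions_finite:
  assumes x: "x \<in> primal_solutions F A Q b c h p"
    and "\<And>w. h w \<noteq> -\<infinity>" "\<And>u. p u \<noteq> -\<infinity>"
  obtains hr pr where "h (F x) = ereal hr" "p x = ereal pr"
proof -
  have "\<bar>primal_obj F c h p x\<bar> \<noteq> \<infinity>"
    using x by (simp add: primal_solutions_def minimizers_def)
  then show thesis
    using assms(2)[of "F x"] assms(3)[of x] that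
    by (cases "h (F x)"; cases "p x") (auto simp: primal_obj_def)
qed

lemma feasible_gap_nonneg:
  assumes "x \<in> primal_feasible A Q b" "y \<in> Q"
  shows "inner b y \<le> inner (A x) y"
  using assms by (auto simp: primal_feasible_def polar_cone_def inner_diff_left)

text \<open>By the subgradient inequality at \<open>u\<close>, the gap of \<open>x\<close> is at
  most the objective at \<open>x\<close> minus that at \<open>u\<close>; the terms in
  \<open>h\<close> and \<open>g\<close> cancel since \<open>F u = F x\<close>. Optimality of
  \<open>x\<close> makes this difference nonpositive, feasibility makes the gap nonnegative, so
  equality holds throughout.\<close>

lemma multiplier_intersection_compare:
  fixes F :: "'x::euclidean_space \<Rightarrow> 'w::euclidean_space"
    and A :: "'x \<Rightarrow> 'y::euclidean_space"
  assumes lin: "linear F" "linear A" and Q: "convex_cone Q"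
    and nonmin: "\<And>w. h w \<noteq> -\<infinity>" "\<And>u. p u \<noteq> -\<infinity>"
    and sol: "x \<in> primal_solutions F A Q b c h p"
    and y: "y \<in> Q"
    and sub: "adjoint A y - (adjoint F g + c) \<in> subdiff p u"
    and u: "u \<in> G2 A Q b y" "F u = F x"
  shows "u \<in> primal_solutions F A Q b c h p"
    and "x \<in> G2 A Q b y"
    and "adjoint A y - (adjoint F g + c) \<in> subdiff p x"
proof -
  define v where "v = adjoint A y - (adjoint F g + c)"
  obtain hr pr where r: "h (F x) = ereal hr" "p x = ereal pr"
    using primal_solutions_finite[OF sol nonmin] by blast
  have xf: "x \<in> primal_feasible A Q b"
    and opt: "\<And>z. z \<in> primal_feasible A Q b \<Longrightarrow> primal_obj F c h p x \<le> primal_obj F c h p z"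
    using sol by (auto simp: primal_solutions_def minimizers_def)
  have uf: "u \<in> primal_feasible A Q b" and uy: "inner (A u) y = inner b y"
    using u(1) by (auto simp: G2_eq[OF Q y])
  have sub': "p z \<ge> p u + ereal (inner v (z - u))" for z
    using sub by (simp add: subdiff_def v_def)
  obtain ur where ur: "p u = ereal ur"
    using sub'[of x] r nonmin(2)[of u] by (cases "p u") auto
  have vx: "inner v (x - u) = inner (A x) y - inner b y - inner c x + inner c u"
    using u(2) uy
    by (simp add: v_def inner_diff_left inner_add_left inner_commute[of "adjoint _ _"]
        adjoint_works lin linear_diff inner_diff_left inner_diff_right)
  have le: "ur + inner v (x - u) \<le> pr" using sub'[of x] by (simp add: r ur)
  have ge: "inner c x + pr \<le> inner c u + ur"
    using opt[OF uf] by (simp add: primal_obj_def u(2) r ur)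
  have gap: "inner (A x) y = inner b y"
    using le ge vx feasible_gap_nonneg[OF xf y] by linarith
  show "x \<in> G2 A Q b y" using gap xf by (simp add: G2_eq[OF Q y])
  have eq: "inner c x + pr = inner c u + ur"
    using le ge vx gap by linarith
  then have "primal_obj F c h p u = primal_obj F c h p x"
    by (simp add: primal_obj_def u(2) r ur)
  then show "u \<in> primal_solutions F A Q b c h p"
    using sol uf by (simp add: primal_solutions_def minimizers_def)
  \<comment> \<open>By the equality, the affine minorant of \<open>p\<close> at \<open>u\<close>
    also touches \<open>p\<close> at \<open>x\<close>, so its slope is a subgradient there
    too.\<close>
  have "p x + ereal (inner v (z - x)) = p u + ereal (inner v (z - u))" for z
    using eq vx gap by (simp add: r ur inner_diff_right)
  with sub' show "adjoint A y - (adjoint F g + c) \<in> subdiff p x"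
    by (simp add: subdiff_def flip: v_def)
qed

section \<open>Quantitative estimates near a solution\<close>

text \<open>The gap \<open>l\<close> enters linearly while the other residuals are squared. The
  bound \<open>d3 \<le> 1\<close> reconciles them, since then
  \<open>d3\<^sup>2 \<le> d3 \<le> C3 * l\<close>.\<close>

lemma sq_le_sum_of_error_bounds:
  fixes \<kappa>0 \<kappa>1 \<kappa>2 :: real
  assumes D: "0 \<le> D" "D \<le> \<kappa>0 * max d1 (max d2 d3)"
    and pos: "\<kappa>0 > 0" "\<kappa>1 > 0" "\<kappa>2 > 0" "C3 > 0"
    and d1: "0 \<le> d1" "d1 \<le> C1 * a"
    and d2: "0 \<le> d2"
    and d3: "0 \<le> d3" "d3 \<le> 1" "d3 \<le> C3 * l"
  shows "D\<^sup>2 \<le> \<kappa>0\<^sup>2 * (C1\<^sup>2 / \<kappa>1 + 1 / \<kappa>2 + C3) * (\<kappa>1 * a\<^sup>2 + \<kappa>2 * d2\<^sup>2 + l)"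
proof -
  have l: "0 \<le> l"
    using order_trans[OF d3(1) d3(3)] mult_le_cancel_left_pos[OF pos(4), of 0 l] by simp
  define T where "T = \<kappa>1 * a\<^sup>2 + \<kappa>2 * d2\<^sup>2 + l"
  have "(max d1 (max d2 d3))\<^sup>2 \<le> d1\<^sup>2 + d2\<^sup>2 + d3\<^sup>2"
    by (auto simp: max_def)
  moreover have "d1\<^sup>2 \<le> (C1\<^sup>2 / \<kappa>1) * T"
  proof -
    have "d1\<^sup>2 \<le> (C1 * a)\<^sup>2" using d1 by (rule power_mono[rotated])
    also have "\<dots> = (C1\<^sup>2 / \<kappa>1) * (\<kappa>1 * a\<^sup>2)" using pos by (simp add: power_mult_distrib)
    also have "\<dots> \<le> (C1\<^sup>2 / \<kappa>1) * T"
      using pos l by (intro mult_left_mono) (auto simp: T_def)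
    finally show ?thesis .
  qed
  moreover have "d2\<^sup>2 \<le> (1 / \<kappa>2) * T"
    using pos l by (simp add: T_def field_simps)
  moreover have "d3\<^sup>2 \<le> C3 * T"
  proof -
    have "d3\<^sup>2 \<le> d3" using d3 by (simp add: power2_eq_square mult_left_le)
    also have "\<dots> \<le> C3 * l" by (rule d3)
    also have "\<dots> \<le> C3 * T" using pos by (intro mult_left_mono) (auto simp: T_def)
    finally show ?thesis .
  qed
  ultimately have "(max d1 (max d2 d3))\<^sup>2 \<le> (C1\<^sup>2 / \<kappa>1 + 1 / \<kappa>2 + C3) * T"
    by (simp add: distrib_right)
  then have "\<kappa>0\<^sup>2 * (max d1 (max d2 d3))\<^sup>2 \<le> \<kappa>0\<^sup>2 * ((C1\<^sup>2 / \<kappa>1 + 1 / \<kappa>2 + C3) * T)"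
    by (intro mult_left_mono) auto
  moreover have "D\<^sup>2 \<le> \<kappa>0\<^sup>2 * (max d1 (max d2 d3))\<^sup>2"
    using power_mono[OF D(2,1), of 2] by (simp add: power_mult_distrib)
  ultimately show ?thesis by (simp add: T_def mult.assoc)
qed

text \<open>A box containing the unit ball around \<open>x0\<close> cuts the feasible set down to a
  polytope. Its face of zero gap lies in \<open>G2\<close>, so the distance to that face bounds the
  distance to \<open>G2\<close> from above.\<close>

lemma G2_local_error_bound:
  fixes A :: "'x::euclidean_space \<Rightarrow> 'y::euclidean_space"
  assumes A: "linear A" and Q: "polyhedron Q" "convex_cone Q"
    and y: "y \<in> Q" and x0: "x0 \<in> G2 A Q b y"
  shows "\<exists>C>0. \<forall>x\<in>ball x0 1 \<inter> primal_feasible A Q b.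
           infdist x (G2 A Q b y) \<le> C * (inner (A x) y - inner b y)"
proof -
  define P where "P = primal_feasible A Q b \<inter> cbox (x0 - One) (x0 + One)"
  have d: "inner (adjoint A y) x = inner (A x) y" for x
    by (simp add: inner_commute[of "adjoint A y"] adjoint_works[OF A])
  have x0f: "x0 \<in> primal_feasible A Q b" and x0y: "inner (A x0) y = inner b y"
    using x0 by (auto simp: G2_eq[OF Q(2) y])
  have "polytope P"
    unfolding P_def
    by (intro polyhedron_Int_polytope polyhedron_primal_feasible A Q polytope_interval)
  moreover have x0P: "x0 \<in> P"
    using x0f by (auto simp: P_def mem_box inner_simps)
  moreover have "inner (adjoint A y) x0 \<le> inner (adjoint A y) x" if "x \<in> P" for x
    using that feasible_gap_nonneg[OF _ y] by (auto simp: d x0y P_def)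
  ultimately obtain C where C: "C > 0"
    "\<And>x. x \<in> P \<Longrightarrow> infdist x {u\<in>P. inner (A u) y = inner b y} \<le> C * (inner (A x) y - inner b y)"
    using polytope_face_error_bound[of P x0 "adjoint A y"] by (auto simp: d x0y)
  have "infdist x (G2 A Q b y) \<le> C * (inner (A x) y - inner b y)"
    if x: "x \<in> ball x0 1" "x \<in> primal_feasible A Q b" for x
  proof -
    have "\<bar>inner (x - x0) i\<bar> \<le> 1" if "i \<in> Basis" for i
      using Basis_le_norm[OF that, of "x - x0"] x(1) by (simp add: dist_norm norm_minus_commute)
    then have "x \<in> P"
      using x(2) by (auto simp: P_def mem_box inner_simps abs_le_iff algebra_simps)
    moreover have "infdist x (G2 A Q b y) \<le> infdist x {u\<in>P. inner (A u) y = inner b y}"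
      using x0P x0y by (intro infdist_mono) (auto simp: G2_eq[OF Q(2) y] P_def)
    ultimately show ?thesis using C(2) order_trans by blast
  qed
  then show ?thesis using C(1) by blast
qed

section \<open>Second order growth from regularity and the residual bounds\<close>

theorem theorem3p1:
  fixes F :: "'x::euclidean_space \<Rightarrow> 'w::euclidean_space"
    and A :: "'x \<Rightarrow> 'y::euclidean_space"
    and Q :: "'y set"
    and b :: 'y
    and c :: 'x
    and h :: "'w \<Rightarrow> ereal"
    and p :: "'x \<Rightarrow> ereal"
  assumes linF: "linear F" and linA: "linear A"
    and Q: "polyhedron Q" "convex_cone Q"
    and p: "closed_proper_convex p"
    and h_proper: "\<forall>w. h w \<noteq> -\<infinity>"
    and h_dom: "edom h \<noteq> {}" "open (edom h)" "convex (edom h)"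
    and h_C1: "continuously_differentiable_on (edom h) h"
    and h_strict: "\<forall>C. convex C \<and> C \<subseteq> edom h \<longrightarrow> strictly_convex_on C h"
    and kkt: "kkt_points F A Q b c h p \<noteq> {}"
    and growth_h: "\<forall>w\<in>edom h. \<exists>\<kappa>\<^sub>1>0. \<exists>W. open W \<and> w \<in> W \<and>
          (\<forall>w'\<in>W. h w' \<ge> h w + ereal (inner (grad h w) (w' - w))
                          + ereal (\<kappa>\<^sub>1 * (norm (w' - w))\<^sup>2))"
    and growth_p: "\<forall>x v. v \<in> subdiff p x \<longrightarrow> (\<exists>\<kappa>\<^sub>2>0. \<exists>U. open U \<and> x \<in> U \<and>
          (\<forall>x'\<in>U. p x' \<ge> p x + ereal (inner v (x' - x))
                          + ereal (\<kappa>\<^sub>2 * (infdist x' (subdiff_inv p v))\<^sup>2)))"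
    and regular: "\<exists>ybar wbar sbar. (ybar, wbar, sbar) \<in> dual_solutions F A Q b c h p \<and>
          boundedly_linearly_regular
            {V_bar F A Q b c h p, G1 F A Q b c h p ybar, G2 A Q b ybar}"
  shows "\<forall>xbar\<in>primal_solutions F A Q b c h p. \<exists>\<kappa>>0. \<exists>U. open U \<and> xbar \<in> U \<and>
          (\<forall>x\<in>U \<inter> primal_feasible A Q b.
             primal_obj F c h p x \<ge> primal_obj F c h p xbar
               + ereal (\<kappa> * (infdist x (primal_solutions F A Q b c h p))\<^sup>2))"
proof
  fix xbar assume xbar: "xbar \<in> primal_solutions F A Q b c h p"
  let ?\<Omega> = "primal_solutions F A Q b c h p"
  have nonmin: "\<And>w. h w \<noteq> -\<infinity>" "\<And>u. p u \<noteq> -\<infinity>"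
    using h_proper p unfolding closed_proper_convex_def proper_def by blast+
  obtain y where blr: "boundedly_linearly_regular
      {V_bar F A Q b c h p, G1 F A Q b c h p y, G2 A Q b y}"
    using regular by blast
  \<comment> \<open>The choice made in \<open>zeta_bar\<close> is again a primal solution, hence has
    the same image as \<open>xbar\<close>.\<close>
  have "(SOME x. x \<in> ?\<Omega>) \<in> ?\<Omega>" using xbar by (rule someI)
  then have zeta: "zeta_bar F A Q b c h p = F xbar"
    unfolding zeta_bar_def
    by (rule primal_solutions_same_image[OF linF linA p h_proper h_dom(3) h_strict _ xbar])
  define g where "g = grad h (F xbar)"
  define v where "v = adjoint A y - (adjoint F g + c)"
  have V: "V_bar F A Q b c h p = {u. F u = F xbar}" by (simp add: V_bar_def zeta)
  have G: "G1 F A Q b c h p y = subdiff_inv p v"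
    by (simp add: G1_def eta_bar_def zeta v_def g_def)
  define D where "D = {u. F u = F xbar} \<inter> subdiff_inv p v \<inter> G2 A Q b y"
  have ne: "D \<noteq> {}" and reg: "\<exists>\<kappa>>0. \<forall>x\<in>B. infdist x D \<le> \<kappa> *
      max (infdist x {u. F u = F xbar}) (max (infdist x (subdiff_inv p v)) (infdist x (G2 A Q b y)))"
    if "bounded B" for B
    using blr that unfolding boundedly_linearly_regular_def V G D_def by (auto simp: Int_assoc)
  \<comment> \<open>The empty set serves as the bounded set on which \<open>ne\<close> is
    conditioned.\<close>
  have D: "D \<noteq> {}" using ne[of "{}"] by simp
  then obtain u where u: "F u = F xbar" "v \<in> subdiff p u" "u \<in> G2 A Q b y"
    by (auto simp: D_def subdiff_inv_def)
  \<comment> \<open>The normal cone is empty outside \<open>Q\<close>, so a point of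
    \<open>G2\<close> forces membership.\<close>
  have y: "y \<in> Q"
    using u(3) by (auto simp: G2_def normal_cone_def split: if_splits)
  note compare = multiplier_intersection_compare[OF linF linA Q(2) nonmin xbar y,
      of g, folded v_def]
  have D\<Omega>: "D \<subseteq> ?\<Omega>"
    using compare(1) by (auto simp: D_def subdiff_inv_def)
  have xG2: "xbar \<in> G2 A Q b y" and vx: "v \<in> subdiff p xbar"
    using compare(2,3) u by blast+
  obtain hr pr where r: "h (F xbar) = ereal hr" "p xbar = ereal pr"
    using primal_solutions_finite[OF xbar nonmin] by blast
  have "F xbar \<in> edom h" by (simp add: edom_def r)
  then obtain \<kappa>1 W where W: "\<kappa>1 > 0" "open W" "F xbar \<in> W"
      "\<And>w. w \<in> W \<Longrightarrow> h w \<ge> h (F xbar) + ereal (inner g (w - F xbar))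
         + ereal (\<kappa>1 * (norm (w - F xbar))\<^sup>2)"
    using growth_h unfolding g_def by blast
  obtain \<kappa>2 U where U: "\<kappa>2 > 0" "open U" "xbar \<in> U"
      "\<And>x. x \<in> U \<Longrightarrow> p x \<ge> p xbar + ereal (inner v (x - xbar))
         + ereal (\<kappa>2 * (infdist x (subdiff_inv p v))\<^sup>2)"
    using growth_p vx by blast
  obtain \<kappa>0 where \<kappa>0: "\<kappa>0 > 0" "\<And>x. x \<in> ball xbar 1 \<Longrightarrow> infdist x D \<le> \<kappa>0 *
      max (infdist x {u. F u = F xbar}) (max (infdist x (subdiff_inv p v)) (infdist x (G2 A Q b y)))"
    using reg[OF bounded_ball] by blast
  obtain C1 where C1: "C1 > 0" "\<And>x. infdist x {u. F u = F xbar} \<le> C1 * norm (F x - F xbar)"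
    using linear_fibre_error_bound[OF linF] by blast
  obtain C3 where C3: "C3 > 0" "\<And>x. x \<in> ball xbar 1 \<Longrightarrow> x \<in> primal_feasible A Q b \<Longrightarrow>
      infdist x (G2 A Q b y) \<le> C3 * (inner (A x) y - inner b y)"
    using G2_local_error_bound[OF linA Q y xG2] by blast
  define M where "M = \<kappa>0\<^sup>2 * (C1\<^sup>2 / \<kappa>1 + 1 / \<kappa>2 + C3)"
  have M: "M > 0"
    unfolding M_def using \<kappa>0(1) C1(1) W(1) U(1) C3(1) by (intro mult_pos_pos add_pos_pos) auto
  \<comment> \<open>The unit ball serves regularity and the bound for the gap; the other two sets
    make the growth conditions of \<open>p\<close> and \<open>h\<close> available.\<close>
  define N where "N = ball xbar 1 \<inter> U \<inter> F -` W"
  have N: "open N" "xbar \<in> N"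
    unfolding N_def using U W linF
    by (auto intro!: open_Int open_vimage linear_continuous_on simp: linear_linear)
  have "primal_obj F c h p x \<ge> primal_obj F c h p xbar + ereal (1 / M * (infdist x ?\<Omega>)\<^sup>2)"
    if x: "x \<in> N" "x \<in> primal_feasible A Q b" for x
  proof -
    have xN: "x \<in> ball xbar 1" "x \<in> U" "F x \<in> W" using x(1) by (auto simp: N_def)
    define a where "a = norm (F x - F xbar)"
    define d2 where "d2 = infdist x (subdiff_inv p v)"
    define l where "l = inner (A x) y - inner b y"
    have xy: "inner (A xbar) y = inner b y" using xG2 by (simp add: G2_eq[OF Q(2) y])
    have "infdist x ?\<Omega> \<le> infdist x D" by (rule infdist_mono[OF D\<Omega> D])
    then have "(infdist x ?\<Omega>)\<^sup>2 \<le> (infdist x D)\<^sup>2" by (simp add: infdist_nonneg power_mono)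
    also have "(infdist x D)\<^sup>2 \<le> M * (\<kappa>1 * a\<^sup>2 + \<kappa>2 * d2\<^sup>2 + l)"
      unfolding M_def
    proof (rule sq_le_sum_of_error_bounds[OF infdist_nonneg \<kappa>0(2)[OF xN(1), folded d2_def]])
      \<comment> \<open>The point \<open>xbar\<close> lies in \<open>G2\<close> and is within
        distance 1 of \<open>x\<close>.\<close>
      show "infdist x (G2 A Q b y) \<le> 1"
        using infdist_le[OF xG2, of x] xN(1) by (simp add: dist_commute)
      show "infdist x (G2 A Q b y) \<le> C3 * l" using C3(2)[OF xN(1) x(2)] by (simp add: l_def)
      show "infdist x {u. F u = F xbar} \<le> C1 * a" using C1(2) by (simp add: a_def)
    qed (auto simp: infdist_nonneg d2_def \<kappa>0 W U C3)
    finally have dist: "1 / M * (infdist x ?\<Omega>)\<^sup>2 \<le> \<kappa>1 * a\<^sup>2 + \<kappa>2 * d2\<^sup>2 + l"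
      using M by (simp add: field_simps)
    have hge: "h (F x) \<ge> ereal (hr + inner g (F x - F xbar) + \<kappa>1 * a\<^sup>2)"
      using W(4)[OF xN(3)] by (simp add: r a_def)
    have pge: "p x \<ge> ereal (pr + inner v (x - xbar) + \<kappa>2 * d2\<^sup>2)"
      using U(4)[OF xN(2)] by (simp add: r d2_def)
    \<comment> \<open>Taking adjoints, the first order terms of \<open>h\<close>, \<open>p\<close>
      and \<open>c\<close> add up to exactly the gap \<open>l\<close>.\<close>
    have "inner v (x - xbar) = l - inner g (F x - F xbar) - inner c x + inner c xbar"
      by (simp add: v_def l_def inner_diff_left inner_add_left inner_commute[of "adjoint _ _"]
          adjoint_works linF linA linear_diff inner_diff_right inner_commute[of g] flip: xy)
    then have "hr + inner c xbar + pr + 1 / M * (infdist x ?\<Omega>)\<^sup>2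
      \<le> (hr + inner g (F x - F xbar) + \<kappa>1 * a\<^sup>2) + inner c x
        + (pr + inner v (x - xbar) + \<kappa>2 * d2\<^sup>2)"
      using dist by linarith
    then have "primal_obj F c h p xbar + ereal (1 / M * (infdist x ?\<Omega>)\<^sup>2)
      \<le> ereal (hr + inner g (F x - F xbar) + \<kappa>1 * a\<^sup>2) + ereal (inner c x)
        + ereal (pr + inner v (x - xbar) + \<kappa>2 * d2\<^sup>2)"
      by (simp add: primal_obj_def r)
    also have "\<dots> \<le> primal_obj F c h p x"
      unfolding primal_obj_def by (intro add_mono hge pge order_refl)
    finally show ?thesis .
  qed
  then show "\<exists>\<kappa>>0. \<exists>U. open U \<and> xbar \<in> U \<and> (\<forall>x\<in>U \<inter> primal_feasible A Q b.
      primal_obj F c h p x \<ge> primal_obj F c h p xbar + ereal (\<kappa> * (infdist x ?\<Omega>)\<^sup>2))"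
    using N M by (intro exI[of _ "1 / M"] conjI exI[of _ N]) auto
qed

end
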